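(* For all integers $d\ge 1$ and $0\le m<d$ there is a constant $f(d,m)>0$, depending only on $d$ and $m$ and not on $n$, such that the following holds for every integer $n\ge 1$. Partition the cube $Q^d=[0,1]^d$ into the $n^d$ small cubes $\prod_{j=1}^d [a_j/n,(a_j+1)/n]$, where $a_j\in\{0,\dots,n-1\}$. If each of these small cubes is colored in one of $m+1$ colors, then there exists a monochromatic connected component consisting of at least $f(d,m)\, n^{d-m}$ small cubes.
   Context: Two small cubes are adjacent (connected) if they have nonempty intersection as closed sets. A monochromatic connected component is a maximal set of small cubes of the same color that is connected under this adjacency relation. *)

theory Defs
  imports Complex_Main "HOL-Library.FuncSet"
begin

text \<open>Points of \<open>\<real>\<^sup>d\<close> are functions \<open>nat \<Rightarrow> real\<close> that are extensional on the coordinate set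
  \<open>{..<d}\<close>; coordinates are numbered from 0.\<close>

definition small_cube :: "nat \<Rightarrow> nat \<Rightarrow> (nat \<Rightarrow> nat) \<Rightarrow> (nat \<Rightarrow> real) set" where
  "small_cube d n a = (\<Pi>\<^sub>E j\<in>{..<d}. {real (a j) / real n .. (real (a j) + 1) / real n})"

definition small_cubes :: "nat \<Rightarrow> nat \<Rightarrow> (nat \<Rightarrow> real) set set" where
  "small_cubes d n = small_cube d n ` ({..<d} \<rightarrow>\<^sub>E {..<n})"

definition adjacent :: "'a set \<Rightarrow> 'a set \<Rightarrow> bool" where
  "adjacent A B \<longleftrightarrow> A \<inter> B \<noteq> {}"

text \<open>Any two members are joined by a chain of adjacent members that stays inside the family.\<close>

definition connected_family :: "'a set set \<Rightarrow> bool" where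
  "connected_family S \<longleftrightarrow>
     (\<forall>A\<in>S. \<forall>B\<in>S. (A, B) \<in> {(P, R). P \<in> S \<and> R \<in> S \<and> adjacent P R}\<^sup>*)"

definition monochromatic_connected ::
    "'a set set \<Rightarrow> ('a set \<Rightarrow> 'c) \<Rightarrow> 'a set set \<Rightarrow> bool" where
  "monochromatic_connected \<Q> col S \<longleftrightarrow>
     S \<subseteq> \<Q> \<and> S \<noteq> {} \<and> (\<exists>k. \<forall>A\<in>S. col A = k) \<and> connected_family S"

definition monochromatic_component ::
    "'a set set \<Rightarrow> ('a set \<Rightarrow> 'c) \<Rightarrow> 'a set set \<Rightarrow> bool" where
  "monochromatic_component \<Q> col S \<longleftrightarrow>
     monochromatic_connected \<Q> col S \<and>
     (\<forall>T. monochromatic_connected \<Q> col T \<and> S \<subseteq> T \<longrightarrow> T = S)"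

lemma inj_on_small_cube:
  assumes "n \<ge> 1"
  shows "inj_on (small_cube d n) ({..<d} \<rightarrow>\<^sub>E {..<n})"
proof (rule inj_onI)
  fix a b
  assume a: "a \<in> {..<d} \<rightarrow>\<^sub>E {..<n}" and b: "b \<in> {..<d} \<rightarrow>\<^sub>E {..<n}"
    and eq: "small_cube d n a = small_cube d n b"
  define I where "I k = {real k / real n .. (real k + 1) / real n}" for k :: nat
  have ne: "I k \<noteq> {}" for k
    using assms by (simp add: I_def divide_right_mono)
  have "(\<Pi>\<^sub>E j\<in>{..<d}. I (a j)) = (\<Pi>\<^sub>E j\<in>{..<d}. I (b j))"
    using eq by (simp only: small_cube_def I_def)
  then have "\<forall>j\<in>{..<d}. I (a j) = I (b j)"
    using PiE_eq_iff_not_empty[of "{..<d}" "\<lambda>j. I (a j)" "\<lambda>j. I (b j)"] ne by simp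
  then have "\<forall>j\<in>{..<d}. Inf (I (a j)) = Inf (I (b j))"
    by simp
  then have "\<forall>j\<in>{..<d}. real (a j) / real n = real (b j) / real n"
    using ne by (simp add: I_def)
  then have "\<forall>j\<in>{..<d}. a j = b j"
    using assms by simp
  then show "a = b" using a b by (auto intro: PiE_ext)
qed

lemma card_small_cubes: "n \<ge> 1 \<Longrightarrow> card (small_cubes d n) = n ^ d"
  by (simp add: small_cubes_def card_image inj_on_small_cube card_PiE)

lemma Union_small_cubes:
  assumes "n \<ge> 1"
  shows "\<Union> (small_cubes d n) = ({..<d} \<rightarrow>\<^sub>E {0..1})"
proof (intro equalityI subsetI)
  fix x assume "x \<in> \<Union> (small_cubes d n)"
  then obtain a where a: "a \<in> {..<d} \<rightarrow>\<^sub>E {..<n}" and x: "x \<in> small_cube d n a"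
    by (auto simp: small_cubes_def)
  show "x \<in> {..<d} \<rightarrow>\<^sub>E {0..1}"
  proof (rule PiE_I)
    fix j assume j: "j \<in> {..<d}"
    have aj: "real (a j) + 1 \<le> real n" using PiE_mem[OF a j] by auto
    have xj: "real (a j) / real n \<le> x j" "x j \<le> (real (a j) + 1) / real n"
      using PiE_mem[OF x[unfolded small_cube_def] j] by simp_all
    have "0 \<le> real (a j) / real n" by simp
    moreover have "(real (a j) + 1) / real n \<le> 1" using aj assms by simp
    ultimately have "0 \<le> x j" "x j \<le> 1" using xj by linarith+
    then show "x j \<in> {0..1}" by simp
  next
    fix j assume "j \<notin> {..<d}"
    then show "x j = undefined" by (rule PiE_arb[OF x[unfolded small_cube_def]])
  qed
next
  fix x :: "nat \<Rightarrow> real" assume x: "x \<in> {..<d} \<rightarrow>\<^sub>E {0..1}"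
  have "\<exists>k<n. real k / real n \<le> x j \<and> x j \<le> (real k + 1) / real n" if j: "j \<in> {..<d}" for j
  proof (cases "x j = 1")
    case True
    then show ?thesis using assms by (intro exI[of _ "n - 1"]) auto
  next
    case False
    then have xj: "0 \<le> x j" "x j < 1" using PiE_mem[OF x j] by auto
    define k where "k = nat \<lfloor>x j * real n\<rfloor>"
    have nn: "real n > 0" using assms by simp
    have pos: "0 \<le> x j * real n" using xj by simp
    have k1: "real k \<le> x j * real n" and k2: "x j * real n \<le> real k + 1"
      unfolding k_def using pos by linarith+
    have "x j * real n < real n" using xj nn by simp
    then have "k < n" using k1 by linarith
    then show ?thesis using k1 k2 nn by (intro exI[of _ k]) (auto simp: field_simps)
  qed
  then obtain a where a: "\<And>j. j \<in> {..<d} \<Longrightarrow>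
      a j < n \<and> real (a j) / real n \<le> x j \<and> x j \<le> (real (a j) + 1) / real n"
    by metis
  have "x \<in> small_cube d n (restrict a {..<d})"
    unfolding small_cube_def using a by (intro PiE_I) (simp_all add: PiE_arb[OF x])
  moreover have "restrict a {..<d} \<in> {..<d} \<rightarrow>\<^sub>E {..<n}" using a by auto
  ultimately show "x \<in> \<Union> (small_cubes d n)" unfolding small_cubes_def by blast
qed

end

theory Submission
  imports Defs "HOL-Library.Z2"
begin

text \<open>Suppose every monochromatic component has at most \<open>V\<close> cubes. Regard the cubes as vertices of the
  complex whose simplices are sets of pairwise touching cubes, and label each vertex by its
  component. Touching cubes of one colour have the same label, so a simplex carries at most
  \<open>m + 1\<close> labels. The cochains modulo 2 that detect the simplices with label set \<open>\<alpha>\<close> form a cochain map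
  from the nerve of the components, which has dimension at most \<open>m\<close>.

  Every cocycle of positive degree in the grid is the coboundary of a cochain at most \<open>O(n)\<close> times as
  large: contract the grid to a point by shrinking boxes and average over the point. Starting in
  degree \<open>m\<close>, this gives a null homotopy of the cochain map in which the terms attached to a fixed
  component have total size \<open>O(n\<^sup>m V)\<close>. In degree 0 each component then yields a 0-cocycle, that is, a
  constant function; if \<open>n\<^sup>m V\<close> is small against \<open>n\<^sup>d\<close> it is 0. But the sum of these functions over all
  components is 1, because the homotopy terms cancel in pairs.\<close>

declare add_bit_eq_xor [simp del]

lemma bit_add_self [simp]: "x + x = (0::bit)"
  by (cases x) simp_all

lemma bit_add_left_self [simp]: "x + (x + y) = (y::bit)"
  by (simp flip: add.assoc)

section \<open>Ordered cochains modulo 2\<close>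

primrec faces :: "'a list \<Rightarrow> 'a list list" where
  "faces [] = []"
| "faces (v # l) = l # map ((#) v) (faces l)"

text \<open>Simplices are tuples rather than sets, so a vertex map acts by \<open>map\<close> even
  when it identifies vertices, as retractions and labellings do.\<close>

definition coboundary :: "('a list \<Rightarrow> bit) \<Rightarrow> 'a list \<Rightarrow> bit" where
  "coboundary z l = sum_list (map z (faces l))"

lemma coboundary_Nil [simp]: "coboundary z [] = 0"
  and coboundary_Cons: "coboundary z (v # l) = z l + coboundary (\<lambda>l. z (v # l)) l"
  by (simp_all add: coboundary_def comp_def)

lemma coboundary_add: "coboundary (\<lambda>l. y l + z l) l = coboundary y l + coboundary z l"
  by (simp add: coboundary_def sum_list_addf)

lemma coboundary_zero [simp]: "coboundary (\<lambda>l. 0) l = 0"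
  by (simp add: coboundary_def)

lemma coboundary_sum: "coboundary (\<lambda>l. \<Sum>b\<in>A. z b l) l = (\<Sum>b\<in>A. coboundary (z b) l)"
  by (induction A rule: infinite_finite_induct) (simp_all add: coboundary_add)

lemma coboundary_map: "coboundary (\<lambda>l. z (map g l)) l = coboundary z (map g l)"
proof (induction l arbitrary: z)
  case Nil
  then show ?case by simp
next
  case (Cons v l)
  show ?case
    using Cons.IH[of "\<lambda>l. z (g v # l)"] by (simp add: coboundary_Cons)
qed

section \<open>Prism operators and cochain homotopies\<close>

primrec prism :: "('a \<Rightarrow> 'b) \<Rightarrow> ('a \<Rightarrow> 'b) \<Rightarrow> 'a list \<Rightarrow> 'b list list" where
  "prism g g' [] = []"
| "prism g g' (v # l) = (g v # g' v # map g' l) # map ((#) (g v)) (prism g g' l)"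

definition prism_cochain ::
    "('a \<Rightarrow> 'b) \<Rightarrow> ('a \<Rightarrow> 'b) \<Rightarrow> ('b list \<Rightarrow> bit) \<Rightarrow> 'a list \<Rightarrow> bit" where
  "prism_cochain g g' z l = sum_list (map z (prism g g' l))"

lemma prism_cochain_Nil [simp]: "prism_cochain g g' z [] = 0"
  and prism_cochain_Cons: "prism_cochain g g' z (v # l) =
    z (g v # g' v # map g' l) + prism_cochain g g' (\<lambda>l. z (g v # l)) l"
  by (simp_all add: prism_cochain_def comp_def)

lemma prism_cochain_add:
  "prism_cochain g g' (\<lambda>l. y l + z l) l = prism_cochain g g' y l + prism_cochain g g' z l"
  by (simp add: prism_cochain_def sum_list_addf)

text \<open>Modulo 2 the inner faces of the prism cancel in pairs. Generalizing over
  \<open>z\<close> lets the induction hypothesis be used for \<open>z\<close> with its first entry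
  frozen at \<open>g v\<close>.\<close>

lemma prism_homotopy:
  "coboundary (prism_cochain g g' z) l + prism_cochain g g' (coboundary z) l
    = z (map g l) + z (map g' l)"
proof (induction l arbitrary: z)
  case Nil
  then show ?case by simp
next
  case (Cons v l)
  let ?z = "\<lambda>l. z (g v # l)" and ?y = "\<lambda>l. z (g v # g' v # l)"
  have "coboundary (prism_cochain g g' z) (v # l) = prism_cochain g g' z l
      + (coboundary ?y (map g' l) + coboundary (prism_cochain g g' ?z) l)"
    by (simp add: coboundary_Cons prism_cochain_Cons coboundary_add
        coboundary_map[of ?y])
  moreover have "prism_cochain g g' (coboundary z) (v # l)
     = z (g' v # map g' l) + (?z (map g' l) + coboundary ?y (map g' l))
       + (prism_cochain g g' z l + prism_cochain g g' (coboundary ?z) l)"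
    by (simp add: coboundary_Cons prism_cochain_Cons prism_cochain_add)
  ultimately have "coboundary (prism_cochain g g' z) (v # l) + prism_cochain g g' (coboundary z) (v # l)
     = (coboundary (prism_cochain g g' ?z) l + prism_cochain g g' (coboundary ?z) l)
       + (z (g' v # map g' l) + ?z (map g' l))"
    by (simp add: ac_simps)
  also have "\<dots> = (?z (map g l) + ?z (map g' l)) + (z (g' v # map g' l) + ?z (map g' l))"
    by (simp only: Cons.IH)
  finally show ?case by (simp add: ac_simps)
qed

lemma prism_cochain_eq_0:
  assumes "\<And>\<tau>. \<tau> \<in> set (prism g g' l) \<Longrightarrow> z \<tau> = 0"
  shows "prism_cochain g g' z l = 0"
  using assms by (simp add: prism_cochain_def cong: map_cong)

text \<open>The head is recorded because it ties a prism tuple to a vertex of the base; the later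
  count of supports rests on this.\<close>

lemma prism_props:
  assumes "\<tau> \<in> set (prism g g' l)"
  shows "l \<noteq> []" "\<tau> \<noteq> []" "hd \<tau> = g (hd l)" "length \<tau> = Suc (length l)"
    "set \<tau> \<subseteq> g ` set l \<union> g' ` set l"
  using assms by (induction l arbitrary: \<tau>) (auto, blast)

text \<open>Cochains that vanish on degenerate tuples. Without this a cocycle of even degree may be
  nonzero on constant tuples, which the contraction to a point does not kill.\<close>

definition normalized :: "('a list \<Rightarrow> bit) \<Rightarrow> bool" where
  "normalized z \<longleftrightarrow> (\<forall>l. \<not> distinct_adj l \<longrightarrow> z l = 0)"

text \<open>A prism tuple doubles only one vertex. So if u occurs twice in a row in
  \<open>l\<close>, then \<open>g u\<close> or \<open>g' u\<close> occurs twice in a row in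
  \<open>\<tau>\<close>.\<close>

lemma prism_not_distinct_adj:
  assumes "\<not> distinct_adj l" "\<tau> \<in> set (prism g g' l)"
  shows "\<not> distinct_adj \<tau>"
  using assms
proof (induction l arbitrary: \<tau>)
  case Nil
  then show ?case by simp
next
  case (Cons v l)
  from Cons.prems(1) have "l \<noteq> []" and vl: "v = hd l \<or> \<not> distinct_adj l"
    by (auto simp: distinct_adj_Cons)
  from Cons.prems(2) consider "\<tau> = g v # g' v # map g' l"
    | \<tau>' where "\<tau>' \<in> set (prism g g' l)" "\<tau> = g v # \<tau>'" by auto
  then show ?case
  proof cases
    case 1
    then show ?thesis using vl \<open>l \<noteq> []\<close>
      by (auto simp: distinct_adj_Cons hd_map dest: distinct_adj_mapD)
  next
    case 2
    then show ?thesis using vl Cons.IH[OF _ 2(1)] prism_props[OF 2(1)]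
      by (auto simp: distinct_adj_Cons)
  qed
qed

lemma normalized_prism_cochain: "normalized z \<Longrightarrow> normalized (prism_cochain g g' z)"
  unfolding normalized_def by (auto intro!: prism_cochain_eq_0 dest: prism_not_distinct_adj)

lemma normalized_zero: "normalized (\<lambda>l. 0)"
  by (simp add: normalized_def)

lemma normalized_add: "normalized y \<Longrightarrow> normalized z \<Longrightarrow> normalized (\<lambda>l. y l + z l)"
  by (simp add: normalized_def)

lemma normalized_sum:
  "(\<And>b. b \<in> A \<Longrightarrow> normalized (z b)) \<Longrightarrow> normalized (\<lambda>l. \<Sum>b\<in>A. z b l)"
  by (simp add: normalized_def)

lemma normalized_const:
  assumes "normalized z" "length l \<ge> 2"
  shows "z (map (\<lambda>_. x) l) = 0"
proof -
  obtain u v l' where "l = u # v # l'"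
    using assms(2) by (cases l; cases "tl l") auto
  then have "\<not> distinct_adj (map (\<lambda>_. x) l)" by simp
  then show ?thesis using assms(1) by (simp add: normalized_def)
qed

section \<open>The grid and its contractions\<close>

definition grid :: "nat \<Rightarrow> nat \<Rightarrow> (nat \<Rightarrow> nat) set" where
  "grid d n = {..<d} \<rightarrow>\<^sub>E {..<n}"

definition near :: "nat \<Rightarrow> (nat \<Rightarrow> nat) \<Rightarrow> (nat \<Rightarrow> nat) \<Rightarrow> bool" where
  "near d v w \<longleftrightarrow> (\<forall>j<d. v j \<le> w j + 1 \<and> w j \<le> v j + 1)"

text \<open>Ordered simplices with \<open>k\<close> vertices, that is, of dimension \<open>k - 1\<close>.\<close>

definition simplices :: "nat \<Rightarrow> nat \<Rightarrow> nat \<Rightarrow> (nat \<Rightarrow> nat) list set" where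
  "simplices d n k = {\<sigma>. length \<sigma> = k \<and> set \<sigma> \<subseteq> grid d n \<and> (\<forall>v\<in>set \<sigma>. \<forall>w\<in>set \<sigma>. near d v w)}"

lemma finite_grid [simp]: "finite (grid d n)"
  by (simp add: grid_def finite_PiE)

lemma card_grid: "card (grid d n) = n ^ d"
  by (simp add: grid_def card_PiE)

lemma finite_simplices [simp]: "finite (simplices d n k)"
  by (rule finite_subset[OF _ finite_lists_length_eq[OF finite_grid, of d n k]])
    (auto simp: simplices_def)

lemma card_near_le: "card {w \<in> grid d n. near d v w} \<le> 3 ^ d"
proof -
  have "card {w \<in> grid d n. near d v w} \<le> card (\<Pi>\<^sub>E j\<in>{..<d}. {v j - 1..v j + 1})"
    by (rule card_mono) (auto simp: grid_def near_def PiE_iff extensional_def finite_PiE)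
  also have "\<dots> = (\<Prod>j<d. card {v j - 1..v j + 1})" by (simp add: card_PiE)
  also have "\<dots> \<le> (\<Prod>j<d. 3)" by (rule prod_mono) auto
  finally show ?thesis by simp
qed

text \<open>A simplex that meets \<open>A\<close> in v lies in the neighbourhood of v, so each of
  its \<open>k\<close> entries has at most \<open>3 ^ d\<close> choices.\<close>

lemma card_simplices_meeting_le:
  assumes "A \<subseteq> grid d n"
  shows "card {\<sigma> \<in> simplices d n k. set \<sigma> \<inter> A \<noteq> {}} \<le> card A * 3 ^ (d * k)"
proof -
  have "finite A" using assms finite_subset[OF _ finite_grid] by blast
  let ?N = "\<lambda>v. {w \<in> grid d n. near d v w}"
  have fin: "finite {\<sigma>. set \<sigma> \<subseteq> ?N v \<and> length \<sigma> = k}" for v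
    by (rule finite_lists_length_eq) simp
  have "card {\<sigma> \<in> simplices d n k. set \<sigma> \<inter> A \<noteq> {}}
      \<le> card (\<Union>v\<in>A. {\<sigma>. set \<sigma> \<subseteq> ?N v \<and> length \<sigma> = k})"
    using fin \<open>finite A\<close> by (intro card_mono) (auto simp: simplices_def)
  also have "\<dots> \<le> (\<Sum>v\<in>A. card {\<sigma>. set \<sigma> \<subseteq> ?N v \<and> length \<sigma> = k})"
    by (rule card_UN_le[OF \<open>finite A\<close>])
  also have "\<dots> = (\<Sum>v\<in>A. card (?N v) ^ k)"
    by (simp add: card_lists_length_eq)
  also have "\<dots> \<le> (\<Sum>v\<in>A. (3 ^ d) ^ k)"
    by (intro sum_mono power_mono card_near_le) simp
  finally show ?thesis by (simp add: power_mult)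
qed

section \<open>Shrinking boxes around a base point\<close>

definition clamp :: "nat \<Rightarrow> nat \<Rightarrow> nat \<Rightarrow> nat" where
  "clamp a r x = min (a + r) (max (a - r) x)"

definition retract :: "nat \<Rightarrow> (nat \<Rightarrow> nat) \<Rightarrow> nat \<Rightarrow> (nat \<Rightarrow> nat) \<Rightarrow> (nat \<Rightarrow> nat)" where
  "retract d s r v = (\<lambda>j\<in>{..<d}. clamp (s j) r (v j))"

lemma clamp_less: "a < n \<Longrightarrow> x < n \<Longrightarrow> clamp a r x < n"
  by (auto simp: clamp_def)

text \<open>\<open>clamp a r\<close> is the nearest-point projection to [a - r, a + r]; truncating a
  - r at 0 is harmless. Since min and max are 1-Lipschitz in the sup norm, moving point and radius
  by 1 at the same time moves the image by at most 1. Prism tuples mix two radii and need this joint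
  form.\<close>

lemma clamp_near: 
  assumes "x \<le> y + 1" "y \<le> x + 1" "r' = r \<or> r' = Suc r \<or> r = Suc r'"
  shows "clamp a r x \<le> clamp a r' y + 1"
  using assms by (auto simp: clamp_def min_def max_def)

lemma retract_grid: "s \<in> grid d n \<Longrightarrow> v \<in> grid d n \<Longrightarrow> retract d s r v \<in> grid d n"
  by (auto simp: grid_def retract_def PiE_iff clamp_less)

lemma retract_near:
  assumes "near d v w" "r' = r \<or> r' = Suc r \<or> r = Suc r'"
  shows "near d (retract d s r v) (retract d s r' w)"
  unfolding near_def
proof (intro allI impI conjI)
  fix j assume "j < d"
  then have "v j \<le> w j + 1" "w j \<le> v j + 1" using assms(1) by (auto simp: near_def)
  with assms(2) \<open>j < d\<close> show "retract d s r v j \<le> retract d s r' w j + 1"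
    "retract d s r' w j \<le> retract d s r v j + 1"
    using clamp_near[of "v j" "w j" r' r] clamp_near[of "w j" "v j" r r']
    by (auto simp: retract_def)
qed

lemma retract_0: "s \<in> grid d n \<Longrightarrow> retract d s 0 v = s"
  unfolding fun_eq_iff
proof
  fix j assume "s \<in> grid d n"
  then have "\<not> j < d \<Longrightarrow> s j = undefined"
    by (auto simp: grid_def PiE_iff extensional_def)
  then show "retract d s 0 v j = s j"
    by (cases "j < d") (auto simp: retract_def clamp_def)
qed

lemma retract_id: "s \<in> grid d n \<Longrightarrow> v \<in> grid d n \<Longrightarrow> retract d s n v = v"
  unfolding fun_eq_iff
proof
  fix j assume "s \<in> grid d n" "v \<in> grid d n"
  then have "j < d \<Longrightarrow> s j < n \<and> v j < n" "\<not> j < d \<Longrightarrow> v j = undefined"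
    by (auto simp: grid_def PiE_iff extensional_def)
  then show "retract d s n v j = v j"
    by (cases "j < d") (auto simp: retract_def clamp_def)
qed

lemma prism_retract_simplex:
  assumes "s \<in> grid d n" "\<sigma> \<in> simplices d n k"
    "\<tau> \<in> set (prism (retract d s (Suc r)) (retract d s r) \<sigma>)"
  shows "\<tau> \<in> simplices d n (Suc k)"
proof -
  have sub: "set \<tau> \<subseteq> retract d s (Suc r) ` set \<sigma> \<union> retract d s r ` set \<sigma>"
    and len: "length \<tau> = Suc (length \<sigma>)"
    using prism_props[OF assms(3)] by auto
  have "near d v w" if v: "v \<in> set \<tau>" and w: "w \<in> set \<tau>" for v w
  proof -
    have "\<exists>v'\<in>set \<sigma>. \<exists>q\<in>{r, Suc r}. u = retract d s q v'" if "u \<in> set \<tau>" for u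
      using sub that by auto
    then obtain v' w' q r' where "v' \<in> set \<sigma>" "w' \<in> set \<sigma>"
      "v = retract d s q v'" "w = retract d s r' w'" "q \<in> {r, Suc r}" "r' \<in> {r, Suc r}"
      using v w by meson
    then show ?thesis using assms(2) by (auto simp: simplices_def intro!: retract_near)
  qed
  moreover have "set \<tau> \<subseteq> grid d n"
    using sub retract_grid[OF assms(1)] assms(2) unfolding simplices_def by blast
  ultimately show ?thesis using len assms(2) by (auto simp: simplices_def)
qed

text \<open>Only three kinds of pairs contribute: the point is fixed, or the base point is \<open>u - r\<close> or
  \<open>u + r\<close>. So on average over the base point a clamping map is boundedly many to one.\<close>

lemma sum_card_clamp_le: "(\<Sum>a<n. card {x. x < n \<and> clamp a r x = u}) \<le> 3 * n"
proof -
  have "(\<Sum>a<n. card {x. x < n \<and> clamp a r x = u})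
      = card (SIGMA a:{..<n}. {x. x < n \<and> clamp a r x = u})"
    by simp
  also have "\<dots> \<le> card ({..<n} \<times> {u} \<union> ({u - r} \<times> {..<n} \<union> {u + r} \<times> {..<n}))"
    by (intro card_mono) (auto simp: clamp_def min_def max_def split: if_splits)
  also have "\<dots> \<le> card ({..<n} \<times> {u}) + (card ({u - r} \<times> {..<n}) + card ({u + r} \<times> {..<n}))"
    by (intro order.trans[OF card_Un_le] add_left_mono card_Un_le)
  finally show ?thesis by simp
qed

text \<open>A fibre of \<open>retract\<close> lies in a product of one-dimensional fibres, so the
  sum over base points factors over the coordinates. On average over the base point a fibre has at
  most \<open>3 ^ d\<close> points.\<close>

lemma sum_card_retract_le:
  "(\<Sum>s\<in>grid d n. card {v \<in> grid d n. retract d s r v = u}) \<le> (3 * n) ^ d"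
proof -
  let ?c = "\<lambda>j a. card {x. x < n \<and> clamp a r x = u j}"
  have "card {v \<in> grid d n. retract d s r v = u} \<le> (\<Prod>j<d. ?c j (s j))" for s
  proof -
    have "card {v \<in> grid d n. retract d s r v = u}
        \<le> card (\<Pi>\<^sub>E j\<in>{..<d}. {x. x < n \<and> clamp (s j) r x = u j})"
      by (rule card_mono) (auto simp: grid_def retract_def PiE_iff extensional_def finite_PiE)
    then show ?thesis by (simp add: card_PiE)
  qed
  then have "(\<Sum>s\<in>grid d n. card {v \<in> grid d n. retract d s r v = u})
      \<le> (\<Sum>s\<in>grid d n. \<Prod>j<d. ?c j (s j))"
    by (rule sum_mono)
  also have "\<dots> = (\<Prod>j<d. \<Sum>a<n. ?c j a)"
    unfolding grid_def by (rule prod_sum_PiE[symmetric]) auto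
  also have "\<dots> \<le> (\<Prod>j<d. 3 * n)"
    by (intro prod_mono conjI sum_card_clamp_le) simp
  finally show ?thesis by simp
qed

section \<open>Efficient filling of cocycles\<close>

definition support_size :: "nat \<Rightarrow> nat \<Rightarrow> nat \<Rightarrow> ((nat \<Rightarrow> nat) list \<Rightarrow> bit) \<Rightarrow> nat" where
  "support_size d n k z = card {\<sigma> \<in> simplices d n k. z \<sigma> \<noteq> 0}"

lemma support_size_add:
  "support_size d n k (\<lambda>\<sigma>. y \<sigma> + z \<sigma>) \<le> support_size d n k y + support_size d n k z"
  unfolding support_size_def
  by (rule order.trans[OF card_mono card_Un_le]) auto

lemma support_size_zero [simp]: "support_size d n k (\<lambda>\<sigma>. 0) = 0"
  by (simp add: support_size_def)

lemma support_size_sum: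
  "support_size d n k (\<lambda>\<sigma>. \<Sum>b\<in>A. z b \<sigma>) \<le> (\<Sum>b\<in>A. support_size d n k (z b))"
proof (induction A rule: infinite_finite_induct)
  case (insert b A)
  then show ?case
    using support_size_add[of d n k "z b" "\<lambda>\<sigma>. \<Sum>b\<in>A. z b \<sigma>"] by simp
qed simp_all

text \<open>Radius \<open>n\<close> gives the identity of the grid, radius 0 the constant map to
  \<open>s\<close>. Prism tuples are known to be simplices only for consecutive radii, hence
  \<open>n\<close> prisms in place of one.\<close>

definition cone_cochain ::
    "nat \<Rightarrow> nat \<Rightarrow> (nat \<Rightarrow> nat) \<Rightarrow> ((nat \<Rightarrow> nat) list \<Rightarrow> bit) \<Rightarrow> (nat \<Rightarrow> nat) list \<Rightarrow> bit" where
  "cone_cochain d n s z \<sigma> =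
     (\<Sum>r<n. prism_cochain (retract d s (Suc r)) (retract d s r) z \<sigma>)"

lemma normalized_cone_cochain: "normalized z \<Longrightarrow> normalized (cone_cochain d n s z)"
  unfolding cone_cochain_def by (intro normalized_sum normalized_prism_cochain)

lemma sum_telescope_bit: "(\<Sum>r<n. a (Suc r) + a r) = a n + (a 0 :: bit)"
  by (induction n) (simp_all add: ac_simps)

lemma coboundary_cone_cochain:
  assumes "s \<in> grid d n" "normalized z" "k \<ge> 1" "\<sigma> \<in> simplices d n (Suc k)"
    and cocycle: "\<And>\<tau>. \<tau> \<in> simplices d n (Suc (Suc k)) \<Longrightarrow> coboundary z \<tau> = 0"
  shows "coboundary (cone_cochain d n s z) \<sigma> = z \<sigma>"
proof -
  let ?g = "retract d s"
  have "coboundary (cone_cochain d n s z) \<sigma>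
      = (\<Sum>r<n. coboundary (prism_cochain (?g (Suc r)) (?g r) z) \<sigma>)"
    unfolding cone_cochain_def[abs_def] by (rule coboundary_sum)
  also have "\<dots> = (\<Sum>r<n. z (map (?g (Suc r)) \<sigma>) + z (map (?g r) \<sigma>))"
  proof (rule sum.cong[OF refl])
    fix r
    have "prism_cochain (?g (Suc r)) (?g r) (coboundary z) \<sigma> = 0"
      by (intro prism_cochain_eq_0 cocycle prism_retract_simplex[OF assms(1,4)])
    with prism_homotopy[of "?g (Suc r)" "?g r" z \<sigma>]
    show "coboundary (prism_cochain (?g (Suc r)) (?g r) z) \<sigma>
        = z (map (?g (Suc r)) \<sigma>) + z (map (?g r) \<sigma>)" by simp
  qed
  also have "\<dots> = z (map (?g n) \<sigma>) + z (map (?g 0) \<sigma>)"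
    by (rule sum_telescope_bit)
  also have "map (?g n) \<sigma> = \<sigma>"
    using assms(1,4) by (auto simp: simplices_def retract_id intro!: map_idI)
  also have "map (?g 0) \<sigma> = map (\<lambda>_. s) \<sigma>"
    using retract_0[OF assms(1)] by simp
  \<comment> \<open>Here \<open>k \<ge> 1\<close> matters: the constant tuple has at least two
    entries and is degenerate.\<close>
  also have "z (map (\<lambda>_. s) \<sigma>) = 0"
    using assms(2,3,4) by (intro normalized_const) (auto simp: simplices_def)
  finally show ?thesis by simp
qed

text \<open>If the value at \<open>\<sigma>\<close> is nonzero, some prism tuple
  \<open>\<tau>\<close> over \<open>\<sigma>\<close> lies in the support of \<open>z\<close>, and
  its head is the image of \<open>hd \<sigma>\<close>. So \<open>\<sigma>\<close> meets the fibre
  over \<open>hd \<tau>\<close>, and the simplices meeting that fibre are counted.\<close>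

lemma support_size_cone_cochain:
  assumes "s \<in> grid d n"
  shows "support_size d n k (cone_cochain d n s z) \<le>
    (\<Sum>r<n. \<Sum>\<tau> | \<tau> \<in> simplices d n (Suc k) \<and> z \<tau> \<noteq> 0.
       card {v \<in> grid d n. retract d s (Suc r) v = hd \<tau>} * 3 ^ (d * k))"
proof -
  let ?Z = "{\<tau> \<in> simplices d n (Suc k). z \<tau> \<noteq> 0}"
  let ?A = "\<lambda>r \<tau>. {v \<in> grid d n. retract d s (Suc r) v = hd \<tau>}"
  let ?S = "\<lambda>r \<tau>. {\<sigma> \<in> simplices d n k. set \<sigma> \<inter> ?A r \<tau> \<noteq> {}}"
  have sub: "{\<sigma> \<in> simplices d n k. cone_cochain d n s z \<sigma> \<noteq> 0} \<subseteq> (\<Union>r\<in>{..<n}. \<Union>\<tau>\<in>?Z. ?S r \<tau>)"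
  proof
    fix \<sigma> assume "\<sigma> \<in> {\<sigma> \<in> simplices d n k. cone_cochain d n s z \<sigma> \<noteq> 0}"
    then have \<sigma>: "\<sigma> \<in> simplices d n k" and "cone_cochain d n s z \<sigma> \<noteq> 0" by auto
    then obtain r where r: "r < n" "prism_cochain (retract d s (Suc r)) (retract d s r) z \<sigma> \<noteq> 0"
      unfolding cone_cochain_def by (meson lessThan_iff sum.neutral)
    then obtain \<tau> where \<tau>: "\<tau> \<in> set (prism (retract d s (Suc r)) (retract d s r) \<sigma>)" "z \<tau> \<noteq> 0"
      using prism_cochain_eq_0 by blast
    have "hd \<sigma> \<in> set \<sigma>" "hd \<tau> = retract d s (Suc r) (hd \<sigma>)"
      using prism_props[OF \<tau>(1)] by auto
    moreover have "\<tau> \<in> ?Z"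
      using prism_retract_simplex[OF assms \<sigma> \<tau>(1)] \<tau>(2) by simp
    moreover have "set \<sigma> \<subseteq> grid d n" using \<sigma> by (simp add: simplices_def)
    ultimately have "\<sigma> \<in> ?S r \<tau>" "\<tau> \<in> ?Z" using \<sigma> by auto
    then show "\<sigma> \<in> (\<Union>r\<in>{..<n}. \<Union>\<tau>\<in>?Z. ?S r \<tau>)"
      using r(1) by blast
  qed
  have "support_size d n k (cone_cochain d n s z) \<le> card (\<Union>r\<in>{..<n}. \<Union>\<tau>\<in>?Z. ?S r \<tau>)"
    unfolding support_size_def by (rule card_mono[OF _ sub]) auto
  also have "\<dots> \<le> (\<Sum>r<n. card (\<Union>\<tau>\<in>?Z. ?S r \<tau>))"
    by (rule card_UN_le) simp
  also have "\<dots> \<le> (\<Sum>r<n. \<Sum>\<tau>\<in>?Z. card (?S r \<tau>))"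
    by (intro sum_mono card_UN_le) simp
  also have "\<dots> \<le> (\<Sum>r<n. \<Sum>\<tau>\<in>?Z. card (?A r \<tau>) * 3 ^ (d * k))"
    by (intro sum_mono card_simplices_meeting_le) auto
  finally show ?thesis .
qed

text \<open>\<open>k\<close> counts vertices: \<open>w\<close> has degree \<open>k - 1\<close> and
  \<open>z\<close> degree \<open>k\<close>. The factor \<open>n\<close> is the number of prisms;
  \<open>3 ^ (d * Suc k)\<close> combines \<open>3 ^ d\<close> for an average fibre with
  \<open>3 ^ (d * k)\<close> for the simplices at a vertex.\<close>

definition filling ::
    "nat \<Rightarrow> nat \<Rightarrow> nat \<Rightarrow> ((nat \<Rightarrow> nat) list \<Rightarrow> bit) \<Rightarrow> ((nat \<Rightarrow> nat) list \<Rightarrow> bit) \<Rightarrow> bool" where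
  "filling d n k z w \<longleftrightarrow> normalized w \<and>
     (\<forall>\<sigma>\<in>simplices d n (Suc k). coboundary w \<sigma> = z \<sigma>) \<and>
     support_size d n k w \<le> 3 ^ (d * Suc k) * n * support_size d n (Suc k) z"

lemma exists_filling:
  assumes "n \<ge> 1" "normalized z" "k \<ge> 1"
    and cocycle: "\<And>\<tau>. \<tau> \<in> simplices d n (Suc (Suc k)) \<Longrightarrow> coboundary z \<tau> = 0"
  shows "\<exists>w. filling d n k z w"
proof -
  let ?Z = "{\<tau> \<in> simplices d n (Suc k). z \<tau> \<noteq> 0}"
  let ?M = "3 ^ (d * Suc k) * n * support_size d n (Suc k) z"
  let ?c = "\<lambda>s. support_size d n k (cone_cochain d n s z)"
  have "\<exists>s\<in>grid d n. ?c s \<le> ?M"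
  proof (rule ccontr)
    assume "\<not> (\<exists>s\<in>grid d n. ?c s \<le> ?M)"
    then have "(\<Sum>s\<in>grid d n. ?M) < (\<Sum>s\<in>grid d n. ?c s)"
      using assms(1) card_grid[of d n] by (intro sum_strict_mono) (auto simp: not_le)
    also have "\<dots> \<le> (\<Sum>s\<in>grid d n. \<Sum>r<n. \<Sum>\<tau>\<in>?Z.
        card {v \<in> grid d n. retract d s (Suc r) v = hd \<tau>} * 3 ^ (d * k))"
      by (intro sum_mono support_size_cone_cochain)
    \<comment> \<open>For a single base point a fibre can be large; with the sum over base points
      innermost, the average bound applies.\<close>
    also have "\<dots> = (\<Sum>r<n. \<Sum>\<tau>\<in>?Z. \<Sum>s\<in>grid d n.
        card {v \<in> grid d n. retract d s (Suc r) v = hd \<tau>} * 3 ^ (d * k))"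
      by (subst sum.swap, rule sum.cong[OF refl], rule sum.swap)
    also have "\<dots> = (\<Sum>r<n. \<Sum>\<tau>\<in>?Z. (\<Sum>s\<in>grid d n.
        card {v \<in> grid d n. retract d s (Suc r) v = hd \<tau>}) * 3 ^ (d * k))"
      by (simp only: sum_distrib_right)
    also have "\<dots> \<le> (\<Sum>r<n. \<Sum>\<tau>\<in>?Z. (3 * n) ^ d * 3 ^ (d * k))"
      by (intro sum_mono mult_right_mono sum_card_retract_le) simp
    also have "\<dots> = (\<Sum>s\<in>grid d n. ?M)"
      by (simp add: card_grid support_size_def power_mult_distrib power_add)
    finally show False by simp
  qed
  then obtain s where s: "s \<in> grid d n" "?c s \<le> ?M" by blast
  have "filling d n k z (cone_cochain d n s z)"
    unfolding filling_def
  proof (intro conjI ballI)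
    show "normalized (cone_cochain d n s z)" by (rule normalized_cone_cochain[OF assms(2)])
    show "coboundary (cone_cochain d n s z) \<sigma> = z \<sigma>" if "\<sigma> \<in> simplices d n (Suc k)" for \<sigma>
      by (rule coboundary_cone_cochain[OF s(1) assms(2,3) that cocycle])
  qed (rule s(2))
  then show ?thesis by blast
qed

section \<open>Labellings\<close>

text \<open>The dual cochain of the simplex \<open>\<alpha>\<close> in the ordered complex: all
  orderings count, and signs are invisible modulo 2.\<close>

definition enumerates :: "'l set \<Rightarrow> 'l list \<Rightarrow> bit" where
  "enumerates \<alpha> l = of_bool (distinct l \<and> set l = \<alpha>)"

lemma enumerates_Cons:
  "enumerates \<alpha> (x # l) = (if x \<in> \<alpha> then enumerates (\<alpha> - {x}) l else 0)"
  by (auto simp: enumerates_def)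

text \<open>Induction on the head x. If x is not in \<open>\<alpha>\<close>, only b = x survives. If
  x is in \<open>\<alpha>\<close>, the induction hypothesis for \<open>\<alpha> - {x}\<close> has
  the extra term b = x, which cancels the face omitting x.\<close>

lemma coboundary_enumerates:
  assumes "finite I" "set l \<subseteq> I"
  shows "coboundary (enumerates \<alpha>) l = (\<Sum>b\<in>I - \<alpha>. enumerates (insert b \<alpha>) l)"
  using assms(2)
proof (induction l arbitrary: \<alpha>)
  case Nil
  then show ?case by (simp add: enumerates_def)
next
  case (Cons x l)
  have "x \<in> I" using Cons.prems by simp
  show ?case
  proof (cases "x \<in> \<alpha>")
    case True
    have "coboundary (enumerates \<alpha>) (x # l) = enumerates \<alpha> l + coboundary (enumerates (\<alpha> - {x})) l"
      using True by (simp add: coboundary_Cons enumerates_Cons)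
    also have "coboundary (enumerates (\<alpha> - {x})) l
        = (\<Sum>b\<in>insert x (I - \<alpha>). enumerates (insert b (\<alpha> - {x})) l)"
    proof -
      have "I - (\<alpha> - {x}) = insert x (I - \<alpha>)" using True \<open>x \<in> I\<close> by blast
      then show ?thesis using Cons.IH[of "\<alpha> - {x}"] Cons.prems by simp
    qed
    also have "\<dots> = enumerates \<alpha> l + (\<Sum>b\<in>I - \<alpha>. enumerates (insert b (\<alpha> - {x})) l)"
      using True assms(1) by (simp add: insert_absorb)
    also have "(\<Sum>b\<in>I - \<alpha>. enumerates (insert b (\<alpha> - {x})) l)
        = (\<Sum>b\<in>I - \<alpha>. enumerates (insert b \<alpha>) (x # l))"
      using True by (intro sum.cong[OF refl]) (auto simp: enumerates_Cons insert_Diff_if)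
    finally show ?thesis by simp
  next
    case False
    have "(\<Sum>b\<in>I - \<alpha>. enumerates (insert b \<alpha>) (x # l)) = (\<Sum>b\<in>{x}. enumerates (insert b \<alpha>) (x # l))"
      using False assms(1) \<open>x \<in> I\<close> by (intro sum.mono_neutral_right) (auto simp: enumerates_Cons)
    then show ?thesis using False
      by (simp add: coboundary_Cons enumerates_Cons)
  qed
qed

text \<open>The ordered pairs (b, c) and (c, b) cancel modulo 2. This is the reason why a coboundary
  applied twice vanishes in the nerve.\<close>

lemma sum_symmetric_pairs_bit:
  fixes g :: "'a \<Rightarrow> 'a \<Rightarrow> bit"
  assumes "finite A" "\<And>b c. g b c = g c b"
  shows "(\<Sum>b\<in>A. \<Sum>c\<in>A - {b}. g b c) = 0"
  using assms(1)
proof (induction A)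
  case (insert x A)
  have "(\<Sum>b\<in>insert x A. \<Sum>c\<in>insert x A - {b}. g b c)
      = (\<Sum>c\<in>A. g x c) + (\<Sum>b\<in>A. \<Sum>c\<in>insert x (A - {b}). g b c)"
    using insert.hyps by (auto simp: insert_Diff_if intro!: arg_cong2[of _ _ _ _ "(+)"] sum.cong)
  also have "(\<Sum>b\<in>A. \<Sum>c\<in>insert x (A - {b}). g b c) = (\<Sum>b\<in>A. g b x + (\<Sum>c\<in>A - {b}. g b c))"
    using insert.hyps by (intro sum.cong) auto
  finally show ?case
    using insert.IH assms(2) by (simp add: sum.distrib)
qed simp

text \<open>The outer \<open>D\<close> is the cost of one filling, the inner \<open>D\<close> the
  share of the pullbacks; each earlier filler is counted at most \<open>m + 2\<close> times.\<close>

primrec filling_constant :: "nat \<Rightarrow> nat \<Rightarrow> nat \<Rightarrow> nat" where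
  "filling_constant D m 0 = 0"
| "filling_constant D m (Suc t) = D * (D + (m + 2) * filling_constant D m t)"

section \<open>Null homotopy of the pullback from the nerve of the labels\<close>

locale labelled_grid =
  fixes d n m V :: nat and f :: "(nat \<Rightarrow> nat) \<Rightarrow> 'l"
  assumes n_pos: "n \<ge> 1"
    and few_labels: "\<And>\<sigma> k. \<sigma> \<in> simplices d n k \<Longrightarrow> card (f ` set \<sigma>) \<le> Suc m"
    and small_fibres: "\<And>i. i \<in> f ` grid d n \<Longrightarrow> card {v \<in> grid d n. f v = i} \<le> V"
begin

definition labels :: "'l set" where
  "labels = f ` grid d n"

definition pullback :: "'l set \<Rightarrow> (nat \<Rightarrow> nat) list \<Rightarrow> bit" where
  "pullback \<alpha> \<sigma> = enumerates \<alpha> (map f \<sigma>)"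

text \<open>The null homotopy evaluated on the dual cochain of \<open>\<alpha>\<close>, one degree
  below \<open>pullback \<alpha>\<close>. The recursion runs from larger label sets to smaller ones,
  and the index t, meant to be \<open>m + 2 - card \<alpha>\<close>, makes it structural. The
  cochain being filled is \<open>corrected t \<alpha>\<close>.\<close>

primrec filler :: "nat \<Rightarrow> 'l set \<Rightarrow> (nat \<Rightarrow> nat) list \<Rightarrow> bit" where
  "filler 0 \<alpha> = (\<lambda>\<sigma>. 0)"
| "filler (Suc t) \<alpha> = (SOME w. filling d n (card \<alpha> - 1)
     (\<lambda>\<sigma>. pullback \<alpha> \<sigma> + (\<Sum>b\<in>labels - \<alpha>. filler t (insert b \<alpha>) \<sigma>)) w)"

definition corrected :: "nat \<Rightarrow> 'l set \<Rightarrow> (nat \<Rightarrow> nat) list \<Rightarrow> bit" where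
  "corrected t \<alpha> \<sigma> = pullback \<alpha> \<sigma> + (\<Sum>b\<in>labels - \<alpha>. filler t (insert b \<alpha>) \<sigma>)"

text \<open>Only simplices with at most \<open>m + 2\<close> vertices matter, so this dominates
  every \<open>3 ^ (d * k)\<close> that occurs.\<close>

abbreviation "D \<equiv> 3 ^ (d * (m + 2)) :: nat"

lemma finite_labels [simp]: "finite labels"
  by (simp add: labels_def)

lemma normalized_pullback: "normalized (pullback \<alpha>)"
proof -
  have "distinct_adj l" if "distinct (map f l)" for l
    using that by (auto simp: distinct_adj_conv_nth distinct_map inj_on_eq_iff nth_eq_iff_index_eq)
  then show ?thesis by (auto simp: normalized_def pullback_def enumerates_def)
qed

text \<open>The bound on the labels of a simplex enters here; it permits the recursion to start from
  the zero filler.\<close>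

lemma pullback_eq_0:
  assumes "\<sigma> \<in> simplices d n k" "card \<alpha> = m + 2"
  shows "pullback \<alpha> \<sigma> = 0"
  using few_labels[OF assms(1)] assms(2) by (auto simp: pullback_def enumerates_def)

lemma coboundary_pullback:
  assumes "\<sigma> \<in> simplices d n k"
  shows "coboundary (pullback \<alpha>) \<sigma> = (\<Sum>b\<in>labels - \<alpha>. pullback (insert b \<alpha>) \<sigma>)"
proof -
  have "set (map f \<sigma>) \<subseteq> labels"
    using assms by (auto simp: simplices_def labels_def)
  then show ?thesis
    unfolding pullback_def[abs_def] coboundary_map
    by (rule coboundary_enumerates[OF finite_labels])
qed

text \<open>The truncated \<open>t - 1\<close> is harmless: for \<open>t = 0\<close> we have \<open>card \<alpha> = m + 2\<close>, so both sides of the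
  coboundary equation vanish on simplices.\<close>

definition filler_spec :: "nat \<Rightarrow> 'l set \<Rightarrow> bool" where
  "filler_spec t \<alpha> \<longleftrightarrow> normalized (filler t \<alpha>) \<and>
     (\<forall>\<sigma>\<in>simplices d n (card \<alpha>). coboundary (filler t \<alpha>) \<sigma> = corrected (t - 1) \<alpha> \<sigma>) \<and>
     (t > 0 \<longrightarrow> support_size d n (card \<alpha> - 1) (filler t \<alpha>)
        \<le> D * n * support_size d n (card \<alpha>) (corrected (t - 1) \<alpha>))"

text \<open>After the homotopy equation is inserted for each \<open>insert b \<alpha>\<close>, every
  pullback occurs twice. What remains is a symmetric sum over ordered pairs of new labels. The case
  \<open>card \<alpha> = 1\<close> serves the final argument in degree 0.\<close>

lemma coboundary_corrected:
  assumes spec: "\<And>\<beta>. \<beta> \<subseteq> labels \<Longrightarrow> card \<beta> + t = m + 2 \<Longrightarrow> card \<beta> \<ge> 2 \<Longrightarrow> filler_spec t \<beta>"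
    and \<alpha>: "\<alpha> \<subseteq> labels" "card \<alpha> + Suc t = m + 2" "card \<alpha> \<ge> 1"
    and \<tau>: "\<tau> \<in> simplices d n (Suc (card \<alpha>))"
  shows "coboundary (corrected t \<alpha>) \<tau> = 0"
proof -
  have "finite \<alpha>" using \<alpha>(1) finite_subset[OF _ finite_labels] by blast
  let ?h = "\<lambda>b c. filler (t - 1) (insert c (insert b \<alpha>)) \<tau>"
  have "coboundary (filler t (insert b \<alpha>)) \<tau> =
      pullback (insert b \<alpha>) \<tau> + (\<Sum>c\<in>labels - \<alpha> - {b}. ?h b c)" if "b \<in> labels - \<alpha>" for b
  proof -
    have "card (insert b \<alpha>) = Suc (card \<alpha>)" using that \<open>finite \<alpha>\<close> by simp
    then have "coboundary (filler t (insert b \<alpha>)) \<tau> = corrected (t - 1) (insert b \<alpha>) \<tau>"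
      using spec[of "insert b \<alpha>"] \<alpha> \<tau> that by (simp add: filler_spec_def)
    moreover have "labels - insert b \<alpha> = labels - \<alpha> - {b}" by blast
    ultimately show ?thesis by (simp add: corrected_def)
  qed
  then have "coboundary (corrected t \<alpha>) \<tau> = (\<Sum>b\<in>labels - \<alpha>. pullback (insert b \<alpha>) \<tau>)
      + (\<Sum>b\<in>labels - \<alpha>. pullback (insert b \<alpha>) \<tau> + (\<Sum>c\<in>labels - \<alpha> - {b}. ?h b c))"
    using coboundary_pullback[OF \<tau>]
    by (simp add: corrected_def[abs_def] coboundary_add coboundary_sum)
  also have "\<dots> = (\<Sum>b\<in>labels - \<alpha>. \<Sum>c\<in>labels - \<alpha> - {b}. ?h b c)"
    by (simp add: sum.distrib)
  also have "\<dots> = 0"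
    by (rule sum_symmetric_pairs_bit) (simp_all add: insert_commute)
  finally show ?thesis .
qed

lemma filler_spec:
  assumes "\<alpha> \<subseteq> labels" "card \<alpha> + t = m + 2" "card \<alpha> \<ge> 2"
  shows "filler_spec t \<alpha>"
  using assms
proof (induction t arbitrary: \<alpha>)
  case 0
  then show ?case
    by (simp add: filler_spec_def normalized_zero corrected_def pullback_eq_0)
next
  case (Suc t)
  have "finite \<alpha>" using Suc.prems(1) finite_subset[OF _ finite_labels] by blast
  have "normalized (corrected t \<alpha>)"
    unfolding corrected_def[abs_def]
  proof (intro normalized_add normalized_pullback normalized_sum)
    fix b assume "b \<in> labels - \<alpha>"
    then have "filler_spec t (insert b \<alpha>)"
      using Suc.prems \<open>finite \<alpha>\<close> by (intro Suc.IH) auto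
    then show "normalized (filler t (insert b \<alpha>))" by (simp add: filler_spec_def)
  qed
  \<comment> \<open>\<open>exists_filling\<close> covers positive degrees only, hence the assumption
    \<open>card \<alpha> \<ge> 2\<close>.\<close>
  moreover obtain k where k: "card \<alpha> = Suc k" "k \<ge> 1"
    using Suc.prems(3) by (cases "card \<alpha>") auto
  moreover have "coboundary (corrected t \<alpha>) \<tau> = 0" if "\<tau> \<in> simplices d n (Suc (Suc k))" for \<tau>
    using coboundary_corrected[OF Suc.IH Suc.prems(1,2)] that k by simp
  ultimately have "\<exists>w. filling d n k (corrected t \<alpha>) w"
    using n_pos by (intro exists_filling)
  then have fill: "filling d n k (corrected t \<alpha>) (filler (Suc t) \<alpha>)"
    using k(1) by (simp add: corrected_def[abs_def] someI_ex)
  have "3 ^ (d * Suc k) \<le> D"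
    using Suc.prems(2) k by (intro power_increasing mult_left_mono) auto
  then have "3 ^ (d * Suc k) * n * support_size d n (Suc k) (corrected t \<alpha>)
      \<le> D * n * support_size d n (Suc k) (corrected t \<alpha>)"
    by (intro mult_right_mono) auto
  with fill have "support_size d n k (filler (Suc t) \<alpha>)
      \<le> D * n * support_size d n (Suc k) (corrected t \<alpha>)"
    unfolding filling_def by linarith
  with fill show ?case
    unfolding filler_spec_def filling_def k(1) by (simp del: filler.simps)
qed

section \<open>Sizes of the homotopy terms at a single label\<close>

definition faces_at :: "nat \<Rightarrow> 'l \<Rightarrow> 'l set set" where
  "faces_at t i = {\<alpha>. \<alpha> \<subseteq> labels \<and> i \<in> \<alpha> \<and> card \<alpha> + t = m + 2}"

lemma finite_faces_at [simp]: "finite (faces_at t i)"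
  by (rule finite_subset[of _ "Pow labels"]) (auto simp: faces_at_def)

text \<open>A simplex has just one label set, so the supports for different \<open>\<alpha>\<close>
  are disjoint, and each simplex in them has a vertex in the fibre of \<open>i\<close>.\<close>

lemma sum_support_pullback:
  assumes "i \<in> labels"
  shows "(\<Sum>\<alpha>\<in>faces_at t i. support_size d n (card \<alpha>) (pullback \<alpha>)) \<le> V * D"
proof -
  define a where "a = m + 2 - t"
  let ?S = "\<lambda>\<alpha>. {\<sigma> \<in> simplices d n a. pullback \<alpha> \<sigma> \<noteq> 0}"
  let ?F = "{v \<in> grid d n. f v = i}"
  have "(\<Sum>\<alpha>\<in>faces_at t i. support_size d n (card \<alpha>) (pullback \<alpha>)) = (\<Sum>\<alpha>\<in>faces_at t i. card (?S \<alpha>))"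
  proof (rule sum.cong[OF refl])
    fix \<alpha> assume "\<alpha> \<in> faces_at t i"
    then have "card \<alpha> = a" by (auto simp: faces_at_def a_def)
    then show "support_size d n (card \<alpha>) (pullback \<alpha>) = card (?S \<alpha>)"
      by (simp add: support_size_def)
  qed
  also have "\<dots> = card (\<Union>\<alpha>\<in>faces_at t i. ?S \<alpha>)"
    by (rule card_UN_disjoint[symmetric]) (auto simp: pullback_def enumerates_def)
  also have "\<dots> \<le> card {\<sigma> \<in> simplices d n a. set \<sigma> \<inter> ?F \<noteq> {}}"
  proof (rule card_mono)
    show "(\<Union>\<alpha>\<in>faces_at t i. ?S \<alpha>) \<subseteq> {\<sigma> \<in> simplices d n a. set \<sigma> \<inter> ?F \<noteq> {}}"
      by (auto simp: faces_at_def pullback_def enumerates_def simplices_def)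
  qed simp
  also have "\<dots> \<le> card ?F * 3 ^ (d * a)"
    by (rule card_simplices_meeting_le) auto
  also have "\<dots> \<le> V * D"
    using assms by (intro mult_mono small_fibres power_increasing mult_left_mono)
      (auto simp: labels_def a_def)
  finally show ?thesis .
qed

text \<open>The number of labels b is not bounded in terms of \<open>d\<close> and \<open>m\<close>,
  so sizes are controlled only summed over all faces at \<open>i\<close>. The pair
  (\<open>\<alpha>\<close>, b) is determined by (\<open>insert b \<alpha>\<close>, b), so each
  \<open>\<beta>\<close> is counted at most \<open>card \<beta>\<close> times.\<close>

lemma sum_support_corrected:
  assumes "i \<in> labels"
    and bound: "(\<Sum>\<beta>\<in>faces_at t i. support_size d n (card \<beta> - 1) (filler t \<beta>)) \<le> X"
  shows "(\<Sum>\<alpha>\<in>faces_at (Suc t) i. support_size d n (card \<alpha>) (corrected t \<alpha>)) \<le> V * D + (m + 2) * X"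
proof -
  let ?S = "faces_at (Suc t) i" and ?N = "\<lambda>\<beta>. support_size d n (card \<beta> - 1) (filler t \<beta>)"
  have fin: "finite \<alpha>" if "\<alpha> \<in> faces_at t' i" for \<alpha> t'
    using that finite_subset[OF _ finite_labels] by (auto simp: faces_at_def)
  have "support_size d n (card \<alpha>) (corrected t \<alpha>)
      \<le> support_size d n (card \<alpha>) (pullback \<alpha>) + (\<Sum>b\<in>labels - \<alpha>. ?N (insert b \<alpha>))"
    if "\<alpha> \<in> ?S" for \<alpha>
  proof -
    have "support_size d n (card \<alpha>) (corrected t \<alpha>) \<le> support_size d n (card \<alpha>) (pullback \<alpha>)
        + (\<Sum>b\<in>labels - \<alpha>. support_size d n (card \<alpha>) (filler t (insert b \<alpha>)))"
      unfolding corrected_def[abs_def]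
      by (rule order.trans[OF support_size_add add_left_mono[OF support_size_sum]])
    also have "(\<Sum>b\<in>labels - \<alpha>. support_size d n (card \<alpha>) (filler t (insert b \<alpha>)))
        = (\<Sum>b\<in>labels - \<alpha>. ?N (insert b \<alpha>))"
      using fin[OF that] by (intro sum.cong) auto
    finally show ?thesis .
  qed
  then have "(\<Sum>\<alpha>\<in>?S. support_size d n (card \<alpha>) (corrected t \<alpha>))
      \<le> (\<Sum>\<alpha>\<in>?S. support_size d n (card \<alpha>) (pullback \<alpha>)) + (\<Sum>\<alpha>\<in>?S. \<Sum>b\<in>labels - \<alpha>. ?N (insert b \<alpha>))"
    unfolding sum.distrib[symmetric] by (rule sum_mono)
  also have "(\<Sum>\<alpha>\<in>?S. \<Sum>b\<in>labels - \<alpha>. ?N (insert b \<alpha>))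
      = (\<Sum>(\<alpha>, b)\<in>(SIGMA \<alpha>:?S. labels - \<alpha>). ?N (insert b \<alpha>))"
    by (rule sum.Sigma) auto
  also have "\<dots> = (\<Sum>(\<beta>, b)\<in>(\<lambda>(\<alpha>, b). (insert b \<alpha>, b)) ` (SIGMA \<alpha>:?S. labels - \<alpha>). ?N \<beta>)"
  proof (subst sum.reindex)
    show "inj_on (\<lambda>(\<alpha>, b). (insert b \<alpha>, b)) (SIGMA \<alpha>:?S. labels - \<alpha>)"
      by (rule inj_on_inverseI[of _ "\<lambda>(\<beta>, b). (\<beta> - {b}, b)"]) auto
  qed (simp add: case_prod_unfold)
  also have "\<dots> \<le> (\<Sum>(\<beta>, b)\<in>(SIGMA \<beta>:faces_at t i. \<beta>). ?N \<beta>)"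
  proof (rule sum_mono2)
    show "finite (SIGMA \<beta>:faces_at t i. \<beta>)" using fin by auto
    show "(\<lambda>(\<alpha>, b). (insert b \<alpha>, b)) ` (SIGMA \<alpha>:?S. labels - \<alpha>) \<subseteq> (SIGMA \<beta>:faces_at t i. \<beta>)"
      using fin[of _ "Suc t"] by (auto simp: faces_at_def card_insert_if)
  qed auto
  also have "\<dots> = (\<Sum>\<beta>\<in>faces_at t i. \<Sum>b\<in>\<beta>. ?N \<beta>)"
    using fin by (intro sum.Sigma[symmetric]) auto
  also have "\<dots> \<le> (\<Sum>\<beta>\<in>faces_at t i. (m + 2) * ?N \<beta>)"
  proof (rule sum_mono)
    fix \<beta> assume "\<beta> \<in> faces_at t i"
    then have "card \<beta> \<le> m + 2" by (auto simp: faces_at_def)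
    then show "(\<Sum>b\<in>\<beta>. ?N \<beta>) \<le> (m + 2) * ?N \<beta>"
      unfolding sum_constant of_nat_id by (rule mult_right_mono) simp
  qed
  also have "\<dots> \<le> (m + 2) * X"
    unfolding sum_distrib_left[symmetric] by (rule mult_left_mono[OF bound]) simp
  finally show ?thesis
    using sum_support_pullback[OF assms(1), of "Suc t"] by linarith
qed

lemma sum_support_filler:
  assumes "i \<in> labels" "t \<le> m"
  shows "(\<Sum>\<alpha>\<in>faces_at t i. support_size d n (card \<alpha> - 1) (filler t \<alpha>))
    \<le> filling_constant D m t * n ^ t * V"
  using assms(2)
proof (induction t)
  case 0
  then show ?case by simp
next
  case (Suc t)
  let ?c = "filling_constant D m t"
  have "(\<Sum>\<alpha>\<in>faces_at (Suc t) i. support_size d n (card \<alpha> - 1) (filler (Suc t) \<alpha>))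
      \<le> (\<Sum>\<alpha>\<in>faces_at (Suc t) i. D * n * support_size d n (card \<alpha>) (corrected t \<alpha>))"
  proof (rule sum_mono)
    fix \<alpha> assume "\<alpha> \<in> faces_at (Suc t) i"
    then have "filler_spec (Suc t) \<alpha>"
      using Suc.prems by (intro filler_spec) (auto simp: faces_at_def)
    then show "support_size d n (card \<alpha> - 1) (filler (Suc t) \<alpha>)
        \<le> D * n * support_size d n (card \<alpha>) (corrected t \<alpha>)"
      by (simp add: filler_spec_def del: filler.simps)
  qed
  also have "\<dots> \<le> D * n * (V * D + (m + 2) * (?c * n ^ t * V))"
    unfolding sum_distrib_left[symmetric]
    using Suc by (intro mult_left_mono sum_support_corrected[OF assms(1)]) auto
  \<comment> \<open>The factor \<open>n ^ t \<ge> 1\<close> gives both terms the same shape.\<close>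
  also have "\<dots> \<le> D * n * (n ^ t * V * D + (m + 2) * (?c * n ^ t * V))"
    using n_pos by (intro mult_left_mono add_right_mono mult_right_mono) auto
  also have "\<dots> = filling_constant D m (Suc t) * n ^ Suc t * V"
    by (simp add: algebra_simps)
  finally show ?case .
qed

section \<open>Degree zero: constant functions and the comparison of sizes\<close>

lemma corrected_singleton_constant:
  assumes "i \<in> labels" "v \<in> grid d n" "s \<in> grid d n"
  shows "corrected m {i} [v] = corrected m {i} [s]"
proof -
  let ?z = "corrected m {i}"
  have step: "?z [u] = ?z [w]" if "u \<in> grid d n" "w \<in> grid d n" "near d u w" for u w
  proof -
    have "[u, w] \<in> simplices d n (Suc (card {i}))"
      using that by (auto simp: simplices_def near_def)
    then have "coboundary ?z [u, w] = 0"
      using assms(1) by (intro coboundary_corrected[OF filler_spec]) auto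
    then show ?thesis
      by (cases "?z [u]"; cases "?z [w]") (simp_all add: coboundary_Cons)
  qed
  \<comment> \<open>As r falls from \<open>n\<close> to 0, the points \<open>retract d s r v\<close>
    form a walk from \<open>v\<close> to \<open>s\<close> in which consecutive points are
    near.\<close>
  have "?z [retract d s r v] = ?z [s]" for r
  proof (induction r)
    case 0
    then show ?case by (simp add: retract_0[OF assms(3)])
  next
    case (Suc r)
    have "near d (retract d s (Suc r) v) (retract d s r v)"
      by (rule retract_near) (auto simp: near_def)
    then have "?z [retract d s (Suc r) v] = ?z [retract d s r v]"
      by (intro step retract_grid assms(2,3))
    with Suc show ?case by simp
  qed
  from this[of n] show ?thesis by (simp add: retract_id[OF assms(3,2)])
qed

lemma grid_size_le: "n ^ d \<le> (D + (m + 2) * filling_constant D m m) * n ^ m * V"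
proof (rule ccontr)
  let ?c = "filling_constant D m m"
  assume "\<not> ?thesis"
  then have large: "(D + (m + 2) * ?c) * n ^ m * V < n ^ d" by simp
  have zero: "corrected m {i} [v] = 0" if i: "i \<in> labels" and v: "v \<in> grid d n" for i v
  proof (rule ccontr)
    assume "corrected m {i} [v] \<noteq> 0"
    then have all: "corrected m {i} [w] \<noteq> 0" if "w \<in> grid d n" for w
      using corrected_singleton_constant[OF i that v] by simp
    \<comment> \<open>A nonzero constant function has all \<open>n ^ d\<close> vertices in its
      support.\<close>
    have "n ^ d = card ((\<lambda>w. [w]) ` grid d n)"
      by (simp add: card_image card_grid inj_on_def)
    also have "\<dots> \<le> support_size d n (card {i}) (corrected m {i})"
      unfolding support_size_def
    proof (rule card_mono)
      show "(\<lambda>w. [w]) ` grid d n \<subseteq> {\<sigma> \<in> simplices d n (card {i}). corrected m {i} \<sigma> \<noteq> 0}"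
        using all by (auto simp: simplices_def near_def)
    qed simp
    also have "\<dots> = (\<Sum>\<alpha>\<in>{{i}}. support_size d n (card \<alpha>) (corrected m \<alpha>))" by simp
    also have "\<dots> \<le> (\<Sum>\<alpha>\<in>faces_at (Suc m) i. support_size d n (card \<alpha>) (corrected m \<alpha>))"
      using i by (intro sum_mono2) (auto simp: faces_at_def)
    also have "\<dots> \<le> V * D + (m + 2) * (?c * n ^ m * V)"
      by (intro sum_support_corrected sum_support_filler i) simp
    also have "\<dots> \<le> n ^ m * V * D + (m + 2) * (?c * n ^ m * V)"
      using n_pos by (intro add_right_mono mult_right_mono) auto
    also have "\<dots> = (D + (m + 2) * ?c) * n ^ m * V"
      by (simp add: algebra_simps)
    finally show False using large by simp
  qed
  obtain v where v: "v \<in> grid d n"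
    using n_pos card_grid[of d n] by fastforce
  then have "f v \<in> labels" by (simp add: labels_def)
  \<comment> \<open>The singleton pullbacks add up to 1 because \<open>v\<close> has exactly one
    label, while each filler of a two-element set occurs twice.\<close>
  have "(0::bit) = (\<Sum>i\<in>labels. corrected m {i} [v])"
    by (simp add: zero v)
  also have "\<dots> = (\<Sum>i\<in>labels. pullback {i} [v]) + (\<Sum>i\<in>labels. \<Sum>b\<in>labels - {i}. filler m {b, i} [v])"
    by (simp add: corrected_def sum.distrib)
  also have "(\<Sum>i\<in>labels. \<Sum>b\<in>labels - {i}. filler m {b, i} [v]) = 0"
    by (rule sum_symmetric_pairs_bit) (simp_all add: insert_commute)
  also have "(\<Sum>i\<in>labels. pullback {i} [v]) = (\<Sum>i\<in>labels. if i = f v then 1 else 0)"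
    by (intro sum.cong) (auto simp: pullback_def enumerates_def)
  also have "\<dots> = 1" using \<open>f v \<in> labels\<close> by simp
  finally show False by simp
qed

end

section \<open>Monochromatic components\<close>

lemma adjacent_small_cube:
  assumes "near d v w" "n \<ge> 1"
  shows "adjacent (small_cube d n v) (small_cube d n w)"
proof -
  \<comment> \<open>If two coordinates differ by at most 1, the larger one lies in both unit
    intervals that start at them.\<close>
  let ?x = "\<lambda>j\<in>{..<d}. real (max (v j) (w j)) / real n"
  have "real (v j) \<le> real (max (v j) (w j))" "real (w j) \<le> real (max (v j) (w j))"
    "real (max (v j) (w j)) \<le> real (v j) + 1" "real (max (v j) (w j)) \<le> real (w j) + 1"
    if "j < d" for j
    using assms(1) that by (auto simp: near_def)
  then have "?x \<in> small_cube d n v" "?x \<in> small_cube d n w"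
    unfolding small_cube_def by (auto simp only: restrict_PiE_iff lessThan_iff atLeastAtMost_iff
        intro!: divide_right_mono)
  then show ?thesis unfolding adjacent_def by blast
qed

definition monochromatic_adjacency :: "'a set set \<Rightarrow> ('a set \<Rightarrow> 'c) \<Rightarrow> ('a set \<times> 'a set) set" where
  "monochromatic_adjacency \<Q> col =
     {(P, R). P \<in> \<Q> \<and> R \<in> \<Q> \<and> col P = col R \<and> adjacent P R}"

text \<open>A chain of equally coloured adjacent cubes from \<open>A\<close> stays in the reachable
  set, since each of its prefixes is such a chain; this gives connectedness. Chains inside a
  monochromatic connected family are of this kind too, which gives maximality.\<close>

lemma monochromatic_component_reachable:
  assumes "A \<in> \<Q>"
  shows "monochromatic_component \<Q> col ((monochromatic_adjacency \<Q> col)\<^sup>* `` {A})"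
proof -
  let ?E = "monochromatic_adjacency \<Q> col"
  let ?S = "?E\<^sup>* `` {A}"
  let ?R = "\<lambda>S. {(P, R). P \<in> S \<and> R \<in> S \<and> adjacent P R}"
  have reach: "B \<in> \<Q> \<and> col B = col A \<and> (A, B) \<in> (?R ?S)\<^sup>*" if "(A, B) \<in> ?E\<^sup>*" for B
    using that
  proof induction
    case base
    then show ?case using assms by simp
  next
    case (step B C)
    have "B \<in> ?S" "C \<in> ?S"
      using step.hyps rtrancl_into_rtrancl[OF step.hyps] by simp_all
    moreover have C: "C \<in> \<Q>" "col B = col C" "adjacent B C"
      using step.hyps(2) by (simp_all add: monochromatic_adjacency_def)
    ultimately have "(B, C) \<in> ?R ?S" by simp
    with step.IH have "(A, C) \<in> (?R ?S)\<^sup>*" by (elim conjE) (rule rtrancl_into_rtrancl)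
    with step.IH C show ?case by simp
  qed
  have "sym ((?R ?S)\<^sup>*)"
    by (intro sym_rtrancl symI) (auto simp: adjacent_def)
  have "connected_family ?S"
    unfolding connected_family_def
  proof (intro ballI)
    fix B C assume "B \<in> ?S" "C \<in> ?S"
    then have "(A, B) \<in> (?R ?S)\<^sup>*" "(A, C) \<in> (?R ?S)\<^sup>*"
      using reach[of B] reach[of C] by simp_all
    then show "(B, C) \<in> (?R ?S)\<^sup>*"
      by (rule rtrancl_trans[OF symD[OF \<open>sym ((?R ?S)\<^sup>*)\<close>]])
  qed
  moreover have "B \<in> \<Q>" "col B = col A" if "B \<in> ?S" for B
    using reach[of B] that by simp_all
  moreover have "A \<in> ?S" by simp
  ultimately have "monochromatic_connected \<Q> col ?S"
    unfolding monochromatic_connected_def by blast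
  moreover have "T = ?S" if T: "monochromatic_connected \<Q> col T" "?S \<subseteq> T" for T
  proof
    have "A \<in> T" using T(2) by auto
    have "?R T \<subseteq> ?E"
      using T(1) unfolding monochromatic_connected_def monochromatic_adjacency_def
      by (intro subrelI) (auto simp only: mem_Collect_eq case_prod_conv)
    then have "(?R T)\<^sup>* \<subseteq> ?E\<^sup>*" by (rule rtrancl_mono)
    moreover have "(A, B) \<in> (?R T)\<^sup>*" if "B \<in> T" for B
      using T(1) \<open>A \<in> T\<close> that by (simp add: monochromatic_connected_def connected_family_def)
    ultimately show "T \<subseteq> ?S" by blast
  qed (rule T(2))
  ultimately show ?thesis unfolding monochromatic_component_def by blast
qed

lemma sym_monochromatic_adjacency: "sym (monochromatic_adjacency \<Q> col)"
  by (auto simp: sym_def monochromatic_adjacency_def adjacent_def)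

lemma large_monochromatic_component:
  fixes col :: "(nat \<Rightarrow> real) set \<Rightarrow> nat"
  assumes "n \<ge> 1" "col \<in> small_cubes d n \<rightarrow> {..<m + 1}" and D_def: "D = 3 ^ (d * (m + 2))"
  shows "\<exists>S. monochromatic_component (small_cubes d n) col S \<and>
    n ^ d \<le> (D + (m + 2) * filling_constant D m m) * n ^ m * card S"
proof -
  let ?Q = "small_cubes d n"
  let ?E = "monochromatic_adjacency ?Q col"
  define f where "f v = ?E\<^sup>* `` {small_cube d n v}" for v
  have cube: "small_cube d n v \<in> ?Q" if "v \<in> grid d n" for v
    using that by (simp add: small_cubes_def grid_def)
  have comp: "monochromatic_component ?Q col (f v)" if "v \<in> grid d n" for v
    unfolding f_def by (rule monochromatic_component_reachable[OF cube[OF that]])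
  have ne: "grid d n \<noteq> {}" using assms(1) card_grid[of d n] by auto
  \<comment> \<open>The maximum is attained, so a bound on \<open>V\<close> speaks about an actual
    component.\<close>
  define V where "V = Max (card ` f ` grid d n)"
  have "V \<in> card ` f ` grid d n"
    unfolding V_def using ne by (intro Max_in) auto
  then obtain v where v: "v \<in> grid d n" "V = card (f v)" by auto
  interpret labelled_grid d n m V f
  proof
    show "card (f ` set \<sigma>) \<le> Suc m" if \<sigma>: "\<sigma> \<in> simplices d n k" for \<sigma> k
    proof -
      let ?g = "\<lambda>v. col (small_cube d n v)"
      have same: "f v = f w" if "v \<in> set \<sigma>" "w \<in> set \<sigma>" "?g v = ?g w" for v w
      proof -
        have "(small_cube d n v, small_cube d n w) \<in> ?E"
          using \<sigma> that adjacent_small_cube[OF _ assms(1)] cube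
          by (auto simp: simplices_def monochromatic_adjacency_def)
        then have vw: "(small_cube d n v, small_cube d n w) \<in> ?E\<^sup>*" by (rule r_into_rtrancl)
        then have "(small_cube d n w, small_cube d n v) \<in> ?E\<^sup>*"
          by (rule symD[OF sym_rtrancl[OF sym_monochromatic_adjacency]])
        with vw show ?thesis
          unfolding f_def Image_singleton
          by (intro Collect_cong iffI) (erule (1) rtrancl_trans[rotated])+
      qed
      \<comment> \<open>Touching cubes of one colour share a component, so on a simplex the label is
        a function of the colour; one vertex is chosen per colour.\<close>
      have h: "f v = (f \<circ> inv_into (set \<sigma>) ?g) (?g v)" if "v \<in> set \<sigma>" for v
        unfolding comp_apply
        using that
        by (intro same inv_into_into f_inv_into_f[of "?g v" ?g "set \<sigma>", symmetric] imageI)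
      have "?g ` set \<sigma> \<subseteq> {..<m + 1}"
        using \<sigma> cube assms(2) by (auto simp: simplices_def Pi_iff)
      then have "f ` set \<sigma> \<subseteq> (f \<circ> inv_into (set \<sigma>) ?g) ` {..<m + 1}"
        using h by blast
      then have "card (f ` set \<sigma>) \<le> card {..<m + 1}"
        by (rule surj_card_le[rotated]) simp
      then show ?thesis by simp
    qed
    show "card {v \<in> grid d n. f v = i} \<le> V" if "i \<in> f ` grid d n" for i
    proof -
      have "finite i"
      proof (rule finite_subset)
        show "i \<subseteq> ?Q"
          using that comp unfolding monochromatic_component_def monochromatic_connected_def by blast
        show "finite ?Q" by (simp add: small_cubes_def finite_PiE)
      qed
      have "card {v \<in> grid d n. f v = i} \<le> card i"
      proof (rule card_inj_on_le[OF _ _ \<open>finite i\<close>])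
        show "inj_on (small_cube d n) {v \<in> grid d n. f v = i}"
          by (rule inj_on_subset[OF inj_on_small_cube[OF assms(1), of d]]) (auto simp: grid_def)
        show "small_cube d n ` {v \<in> grid d n. f v = i} \<subseteq> i"
          by (auto simp: f_def)
      qed
      also have "\<dots> \<le> V" unfolding V_def using that by (intro Max_ge) auto
      finally show ?thesis .
    qed
  qed (rule assms(1))
  have "n ^ d \<le> (D + (m + 2) * filling_constant D m m) * n ^ m * card (f v)"
    unfolding D_def v(2)[symmetric] by (rule grid_size_le)
  with comp[OF v(1)] show ?thesis by blast
qed

theorem theorem1p2:
  fixes d m :: nat
  assumes "d \<ge> 1" and "m < d"
  shows "\<exists>f::real. f > 0 \<and>
    (\<forall>n::nat. n \<ge> 1 \<longrightarrow>
      (\<forall>col :: (nat \<Rightarrow> real) set \<Rightarrow> nat. col \<in> small_cubes d n \<rightarrow> {..<m + 1} \<longrightarrow>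
        (\<exists>S. monochromatic_component (small_cubes d n) col S \<and>
             real (card S) \<ge> f * real n ^ (d - m))))"
proof -
  define D :: nat where "D = 3 ^ (d * (m + 2))"
  \<comment> \<open>\<open>K\<close> depends on \<open>d\<close> and \<open>m\<close> alone;
    cancelling \<open>n ^ m\<close> later leaves the exponent \<open>d - m\<close>.\<close>
  define K where "K = D + (m + 2) * filling_constant D m m"
  have "K > 0" by (simp add: K_def D_def)
  show ?thesis
  proof (intro exI[of _ "1 / real K"] conjI allI impI)
    show "1 / real K > 0" using \<open>K > 0\<close> by simp
    fix n :: nat and col :: "(nat \<Rightarrow> real) set \<Rightarrow> nat"
    assume n: "n \<ge> 1" and col: "col \<in> small_cubes d n \<rightarrow> {..<m + 1}"
    obtain S where S: "monochromatic_component (small_cubes d n) col S"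
      "n ^ d \<le> K * n ^ m * card S"
      using large_monochromatic_component[OF n col D_def] unfolding K_def by blast
    have "n ^ (d - m) * n ^ m = n ^ d" using assms(2) by (simp flip: power_add)
    also have "\<dots> \<le> (K * card S) * n ^ m" using S(2) by (simp only: ac_simps)
    finally have "n ^ (d - m) \<le> K * card S" using n by simp
    then have "real n ^ (d - m) \<le> real K * real (card S)"
      by (metis of_nat_le_iff of_nat_mult of_nat_power)
    then have "1 / real K * real n ^ (d - m) \<le> real (card S)"
      using \<open>K > 0\<close> by (simp add: field_simps)
    with S(1) show "\<exists>S. monochromatic_component (small_cubes d n) col S \<and>
        1 / real K * real n ^ (d - m) \<le> real (card S)" by blast
  qed
qed

end
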